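(* Let $\theta_0\in[-\pi,\pi)^N$ be such that the $\theta_0(i)$, $i\in\{1,\dots,N\}$, are i.i.d. uniform on $[-\pi,\pi)$, and fix an edge $(k,k+1)$ of the ring. Then the probability that a midpoint update of $\theta_0$ at the edge $(k,k+1)$ produces a branch-crossing at time $1$ (i.e., $S^{(0)}_+(k)\notin(-\pi,\pi)$ or $S^{(0)}_-(k)\notin(-\pi,\pi)$) equals $\frac{11}{48}$.
   Context: Let $N\ge2$. For $a\in\mathbb R$, $\operatorname{wrap}_\pi(a):=a-2\pi\lfloor\frac{a+\pi}{2\pi}\rfloor\in[-\pi,\pi)$. The ring has vertices $1,\dots,N$ and edges $(1,2),\dots,(N-1,N),(N,1)$, and indices are read modulo $N$ (so $N+1\equiv1$, $0\equiv N$). Put $\delta_0(i):=\operatorname{wrap}_\pi(\theta_0(i+1)-\theta_0(i))$ for $1\le i\le N$ and $S^{(0)}_\pm(k):=\delta_0(k\pm1)+\tfrac12\delta_0(k)$. A midpoint update at the edge $(k,k+1)$ moves both $\theta_0(k)$ and $\theta_0(k+1)$ to the midpoint of the shortest arc between them on the circle, that is, to $\operatorname{wrap}_\pi(\theta_0(k)+\tfrac12\delta_0(k))=\operatorname{wrap}_\pi(\theta_0(k+1)-\tfrac12\delta_0(k))$ (if $\delta_0(k)=-\pi$, one of the two possible midpoints is chosen with probability $1/2$ each), and leaves all other values unchanged.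
   Formalization: The ring is assumed to have N ≥ 4 vertices instead of N ≥ 2: the claim fails for smaller rings, where the probability of a branch-crossing is 0 for N = 2 and 1/4 for N = 3. *)

theory Defs
  imports "HOL-Probability.Probability"
begin

definition wrap_pi :: "real \<Rightarrow> real" where
  "wrap_pi a = a - 2 * pi * of_int \<lfloor>(a + pi) / (2 * pi)\<rfloor>"

(* The representative of i modulo N in {1..N}; in particular 0 is sent to N and N + 1 to 1. *)
definition ring_index :: "nat \<Rightarrow> nat \<Rightarrow> nat" where
  "ring_index N i = (if N dvd i then N else i mod N)"

(* A configuration is a function on nat of which only the values on the vertices {1..N} matter. *)
definition edge_diff :: "nat \<Rightarrow> (nat \<Rightarrow> real) \<Rightarrow> nat \<Rightarrow> real" where
  "edge_diff N \<theta> i = wrap_pi (\<theta> (ring_index N (i + 1)) - \<theta> (ring_index N i))"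

definition S_plus :: "nat \<Rightarrow> (nat \<Rightarrow> real) \<Rightarrow> nat \<Rightarrow> real" where
  "S_plus N \<theta> k = edge_diff N \<theta> (k + 1) + edge_diff N \<theta> k / 2"

(* Used for k in {1..N} only, so the truncated subtraction is exact. *)
definition S_minus :: "nat \<Rightarrow> (nat \<Rightarrow> real) \<Rightarrow> nat \<Rightarrow> real" where
  "S_minus N \<theta> k = edge_diff N \<theta> (k - 1) + edge_diff N \<theta> k / 2"

(* The midpoint update of \<theta> at the edge (k, k + 1) produces a branch-crossing. This is a condition
   on the configuration before the update: at an antipodal pair (edge_diff N \<theta> k = - pi) it does not
   depend on which of the two midpoints is chosen. *)
definition branch_crossing :: "nat \<Rightarrow> (nat \<Rightarrow> real) \<Rightarrow> nat \<Rightarrow> bool" where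
  "branch_crossing N \<theta> k \<longleftrightarrow> S_plus N \<theta> k \<notin> {-pi<..<pi} \<or> S_minus N \<theta> k \<notin> {-pi<..<pi}"

(* The value 11/48 needs four distinct vertices k - 1, k, k + 1, k + 2, that is N \<ge> 4: then the
   differences at the edges k - 1, k, k + 1 are independent. On smaller rings they are not, and the
   probability of a branch-crossing is 0 for N = 2 and 1/4 for N = 3. *)

end

theory Submission
  imports Defs
begin

text \<open>
  The uniform distribution on the circle is invariant under rotations and reflections, so
  conditionally on the vertices \<open>k\<close> and \<open>k + 1\<close> the two neighbouring differences are independent and
  uniform, and the difference at the edge \<open>k\<close> is itself uniform. Given its value \<open>x\<close>, the sum of \<open>x / 2\<close>
  and a uniform variable lies in \<open>(-\<pi>, \<pi>)\<close> with probability \<open>1 - \<bar>x\<bar> / (4\<pi>)\<close>. Hence there is no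
  branch-crossing with probability \<open>E (1 - \<bar>x\<bar> / (4\<pi>))^2 = 1 - 1/4 + 1/48 = 37/48\<close>.
\<close>

section \<open>Elementary properties of \<open>wrap_pi\<close>\<close>

lemma wrap_pi_eq:
  fixes m :: int
  assumes "a - 2 * pi * of_int m \<in> {-pi..<pi}"
  shows "wrap_pi a = a - 2 * pi * of_int m"
proof -
  have "\<lfloor>(a + pi) / (2 * pi)\<rfloor> = m"
    using assms by (simp add: floor_eq_iff field_simps)
  then show ?thesis by (simp add: wrap_pi_def)
qed

lemma wrap_pi_in: "wrap_pi a \<in> {-pi..<pi}"
proof -
  have "0 \<le> (a + pi) / (2 * pi) - of_int \<lfloor>(a + pi) / (2 * pi)\<rfloor>"
    "(a + pi) / (2 * pi) - of_int \<lfloor>(a + pi) / (2 * pi)\<rfloor> < 1"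
    by linarith+
  then show ?thesis
    by (simp add: wrap_pi_def field_simps)
qed

lemma wrap_pi_add_period: "wrap_pi (a + 2 * pi * of_int m) = wrap_pi a"
proof -
  have "(a + 2 * pi * of_int m + pi) / (2 * pi) = (a + pi) / (2 * pi) + of_int m"
    by (simp add: field_simps)
  then show ?thesis by (simp add: wrap_pi_def algebra_simps)
qed

lemma wrap_pi_measurable [measurable]: "wrap_pi \<in> borel_measurable borel"
  unfolding wrap_pi_def[abs_def] by measurable

section \<open>Rotation and reflection invariance of the uniform law\<close>

abbreviation "unif \<equiv> uniform_measure lborel {-pi..<pi::real}"

lemma prob_space_unif: "prob_space unif"
  by (rule prob_space_uniform_measure) auto

lemma nn_integral_unif:
  assumes [measurable]: "f \<in> borel_measurable borel"
  shows "(\<integral>\<^sup>+x. f x \<partial>unif) = (\<integral>\<^sup>+x. f x * indicator {-pi..<pi} x \<partial>lborel) / ennreal (2 * pi)"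
  by (subst nn_integral_uniform_measure) auto

text \<open>With \<open>c\<close> the residue of \<open>b\<close> in \<open>[0, 2 * pi)\<close>, the
  rotation is an exchange of two intervals: \<open>[-pi, c - pi)\<close> is translated onto
  \<open>[pi - c, pi)\<close> and \<open>[c - pi, pi)\<close> onto \<open>[-pi, pi - c)\<close>.
  Translations preserve Lebesgue measure.\<close>

lemma nn_integral_wrap_pi_diff:
  assumes [measurable]: "f \<in> borel_measurable borel"
  shows "(\<integral>\<^sup>+t. f (wrap_pi (t - b)) \<partial>unif) = (\<integral>\<^sup>+t. f t \<partial>unif)"
proof -
  define m :: int where "m = \<lfloor>b / (2 * pi)\<rfloor>"
  define c where "c = b - 2 * pi * of_int m"
  have b: "b = c + 2 * pi * of_int m"
    by (simp add: c_def)
  have "0 \<le> b / (2 * pi) - of_int m" "b / (2 * pi) - of_int m < 1"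
    unfolding m_def by linarith+
  then have c: "0 \<le> c" "c < 2 * pi"
    unfolding b by (simp_all add: field_simps)
  have w: "wrap_pi (t - b) = wrap_pi (t - c)" for t
    using wrap_pi_add_period[of "t - c" "- m"] by (simp add: b algebra_simps)
  have w1: "wrap_pi (t - b) = t - c + 2 * pi" if "t \<in> {-pi..<c - pi}" for t
    using wrap_pi_eq[of "t - c" "- 1"] c that by (simp add: w)
  have w2: "wrap_pi (t - b) = t - c" if "t \<in> {c - pi..<pi}" for t
    using wrap_pi_eq[of "t - c" 0] c that by (simp add: w)
  have "(\<integral>\<^sup>+t. f (wrap_pi (t - b)) * indicator {-pi..<pi} t \<partial>lborel) =
    (\<integral>\<^sup>+t. f (t - c + 2 * pi) * indicator {-pi..<c - pi} t + f (t - c) * indicator {c - pi..<pi} t \<partial>lborel)"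
  proof (intro nn_integral_cong)
    fix t
    consider "t \<in> {-pi..<c - pi}" | "t \<in> {c - pi..<pi}" | "t < -pi" | "t \<ge> pi"
      by fastforce
    then show "f (wrap_pi (t - b)) * indicator {-pi..<pi} t =
        f (t - c + 2 * pi) * indicator {-pi..<c - pi} t + f (t - c) * indicator {c - pi..<pi} t"
      using c by cases (auto simp: w1 w2 indicator_def)
  qed
  also have "\<dots> = (\<integral>\<^sup>+t. f (t - c + 2 * pi) * indicator {-pi..<c - pi} t \<partial>lborel)
      + (\<integral>\<^sup>+t. f (t - c) * indicator {c - pi..<pi} t \<partial>lborel)"
    by (rule nn_integral_add) auto
  also have "(\<integral>\<^sup>+t. f (t - c + 2 * pi) * indicator {-pi..<c - pi} t \<partial>lborel) =
      (\<integral>\<^sup>+t. f t * indicator {pi - c..<pi} t \<partial>lborel)"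
    by (subst nn_integral_real_affine[where c = 1 and t = "c - 2 * pi"])
       (auto intro!: nn_integral_cong simp: indicator_def)
  also have "(\<integral>\<^sup>+t. f (t - c) * indicator {c - pi..<pi} t \<partial>lborel) =
      (\<integral>\<^sup>+t. f t * indicator {-pi..<pi - c} t \<partial>lborel)"
    by (subst nn_integral_real_affine[where c = 1 and t = c])
       (auto intro!: nn_integral_cong simp: indicator_def)
  also have "(\<integral>\<^sup>+t. f t * indicator {pi - c..<pi} t \<partial>lborel) + (\<integral>\<^sup>+t. f t * indicator {-pi..<pi - c} t \<partial>lborel)
      = (\<integral>\<^sup>+t. f t * indicator {pi - c..<pi} t + f t * indicator {-pi..<pi - c} t \<partial>lborel)"
    by (rule nn_integral_add[symmetric]) auto
  also have "\<dots> = (\<integral>\<^sup>+t. f t * indicator {-pi..<pi} t \<partial>lborel)"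
    using c by (intro nn_integral_cong) (auto simp: indicator_def)
  finally show ?thesis
    by (simp add: nn_integral_unif)
qed

text \<open>Reflection turns \<open>[-pi, pi)\<close> into \<open>(-pi, pi]\<close>; the two differ
  only in the endpoints, a null set.\<close>

lemma nn_integral_unif_uminus:
  assumes [measurable]: "f \<in> borel_measurable borel"
  shows "(\<integral>\<^sup>+t. f (- t) \<partial>unif) = (\<integral>\<^sup>+t. f t \<partial>unif)"
proof -
  have "(\<integral>\<^sup>+t. f (- t) * indicator {-pi..<pi} t \<partial>lborel) = (\<integral>\<^sup>+t. f t * indicator {-pi<..pi} t \<partial>lborel)"
    by (subst nn_integral_real_affine[where c = "-1" and t = 0])
       (auto intro!: nn_integral_cong simp: indicator_def)
  also have "\<dots> = (\<integral>\<^sup>+t. f t * indicator {-pi..<pi} t \<partial>lborel)"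
  proof (rule nn_integral_cong_AE)
    show "AE t in lborel. f t * indicator {-pi<..pi} t = f t * indicator {-pi..<pi} t"
      using AE_lborel_singleton[of pi] AE_lborel_singleton[of "-pi"]
      by eventually_elim (auto simp: indicator_def)
  qed
  finally show ?thesis by (simp add: nn_integral_unif)
qed

text \<open>A reflection followed by a rotation. This form serves the left neighbour, whose angle is
  the one subtracted in the difference.\<close>

lemma nn_integral_wrap_pi_diff_left:
  assumes [measurable]: "f \<in> borel_measurable borel"
  shows "(\<integral>\<^sup>+t. f (wrap_pi (b - t)) \<partial>unif) = (\<integral>\<^sup>+t. f t \<partial>unif)"
proof -
  have "(\<integral>\<^sup>+t. f (wrap_pi (b - t)) \<partial>unif) = (\<integral>\<^sup>+t. f (wrap_pi (- t - (- b))) \<partial>unif)"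
    by simp
  also have "\<dots> = (\<integral>\<^sup>+t. f (wrap_pi (t - (- b))) \<partial>unif)"
    by (rule nn_integral_unif_uminus) auto
  finally show ?thesis
    by (simp only: nn_integral_wrap_pi_diff assms)
qed

section \<open>One-sided probability of no crossing and its second moment\<close>

text \<open>Here \<open>x\<close> is the difference at the updated edge and \<open>y\<close> the one
  at a neighbouring edge. With values in \<open>ennreal\<close>, the joint event becomes a product
  whose factors can be pulled out of the integrals.\<close>

definition noncross :: "real \<Rightarrow> real \<Rightarrow> ennreal" where
  "noncross x y = indicator {-pi<..<pi} (y + x / 2)"

lemma noncross_measurable [measurable]: "case_prod noncross \<in> borel_measurable (borel \<Otimes>\<^sub>M borel)"
  unfolding noncross_def[abs_def] by measurable

text \<open>Shifting the window \<open>(-pi, pi)\<close> by \<open>- x / 2\<close> pushes a piece of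
  length \<open>\<bar>x\<bar> / 2\<close> out of the base interval at one end, which leaves length
  \<open>2 * pi - \<bar>x\<bar> / 2\<close> out of \<open>2 * pi\<close>.\<close>

lemma nn_integral_noncross:
  assumes "x \<in> {-pi..<pi}"
  shows "(\<integral>\<^sup>+y. noncross x y \<partial>unif) = ennreal (1 - \<bar>x\<bar> / (4 * pi))"
proof -
  have "(\<integral>\<^sup>+y. noncross x y * indicator {-pi..<pi} y \<partial>lborel) = 
     (\<integral>\<^sup>+y. indicator {max (- pi) (- pi - x / 2)<..<min pi (pi - x / 2)} y \<partial>lborel)"
  proof (rule nn_integral_cong_AE)
    show "AE y in lborel. noncross x y * indicator {-pi..<pi} y =
        indicator {max (- pi) (- pi - x / 2)<..<min pi (pi - x / 2)} y"
      \<comment> \<open>Only at \<open>y = -pi\<close>, which the open interval omits, can the two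
        sides differ.\<close>
      using AE_lborel_singleton[of "-pi"]
      by eventually_elim (auto simp: noncross_def indicator_def)
  qed
  also have "\<dots> = ennreal (2 * pi - \<bar>x\<bar> / 2)"
    using assms by (auto simp: max_def min_def abs_if)
  finally show ?thesis
    using assms by (simp add: nn_integral_unif divide_ennreal abs_if field_simps)
qed

lemma nn_integral_square_unif:
  "(\<integral>\<^sup>+x. ennreal ((1 - \<bar>x\<bar> / (4 * pi))\<^sup>2) \<partial>unif) = ennreal (37 / 48)"
proof -
  have "(\<integral>\<^sup>+x. ennreal ((1 - \<bar>x\<bar> / (4 * pi))\<^sup>2) * indicator {-pi..<pi} x \<partial>lborel) =
     (\<integral>\<^sup>+x. ennreal ((1 + x / (4 * pi))\<^sup>2) * indicator {-pi..0} x +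
        ennreal ((1 - x / (4 * pi))\<^sup>2) * indicator {0..pi} x \<partial>lborel)"
  proof (rule nn_integral_cong_AE)
    show "AE x in lborel. ennreal ((1 - \<bar>x\<bar> / (4 * pi))\<^sup>2) * indicator {-pi..<pi} x =
       ennreal ((1 + x / (4 * pi))\<^sup>2) * indicator {-pi..0} x +
        ennreal ((1 - x / (4 * pi))\<^sup>2) * indicator {0..pi} x"
      using AE_lborel_singleton[of 0] AE_lborel_singleton[of pi]
      by eventually_elim (auto simp: indicator_def)
  qed
  also have "\<dots> = (\<integral>\<^sup>+x. ennreal ((1 + x / (4 * pi))\<^sup>2) * indicator {-pi..0} x \<partial>lborel) +
        (\<integral>\<^sup>+x. ennreal ((1 - x / (4 * pi))\<^sup>2) * indicator {0..pi} x \<partial>lborel)"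
    by (rule nn_integral_add) auto
  also have "(\<integral>\<^sup>+x. ennreal ((1 + x / (4 * pi))\<^sup>2) * indicator {-pi..0} x \<partial>lborel) =
      ennreal ((4 * pi / 3) * (1 + 0 / (4 * pi)) ^ 3 - (4 * pi / 3) * (1 + (- pi) / (4 * pi)) ^ 3)"
    by (rule nn_integral_FTC_Icc) (auto intro!: derivative_eq_intros)
  also have "(\<integral>\<^sup>+x. ennreal ((1 - x / (4 * pi))\<^sup>2) * indicator {0..pi} x \<partial>lborel) =
      ennreal (- (4 * pi / 3) * (1 - pi / (4 * pi)) ^ 3 - (- (4 * pi / 3)) * (1 - 0 / (4 * pi)) ^ 3)"
    by (rule nn_integral_FTC_Icc) (auto intro!: derivative_eq_intros)
  finally show ?thesis
    by (simp add: nn_integral_unif divide_ennreal ennreal_plus[symmetric] field_simps power3_eq_cube del: ennreal_plus)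
qed


section \<open>Vertices of the ring\<close>

lemma ring_index_mod: "ring_index N i mod N = i mod N"
  by (simp add: ring_index_def dvd_eq_mod_eq_0)

lemma ring_index_in: "N > 0 \<Longrightarrow> ring_index N i \<in> {1..N}"
  using mod_less_divisor[of N i] by (auto simp: ring_index_def dvd_eq_mod_eq_0 Suc_le_eq less_imp_le)

text \<open>The gap \<open>j - i\<close> lies strictly between 0 and \<open>N\<close>, so it is no
  multiple of \<open>N\<close>.\<close>

lemma ring_index_neq:
  assumes "i < j" "j < i + N"
  shows "ring_index N i \<noteq> ring_index N j"
proof
  assume "ring_index N i = ring_index N j"
  then have "j mod N = i mod N"
    by (metis ring_index_mod)
  then have "N dvd j - i"
    using assms by (simp add: mod_eq_dvd_iff_nat)
  then show False
    using assms by (auto dest: dvd_imp_le)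
qed

section \<open>Integration over four independent angles\<close>

text \<open>By independence the joint law is a product measure, from which Fubini peels off one
  coordinate at a time. The outer vertices \<open>a\<close> and \<open>d\<close> are integrated
  innermost, which amounts to conditioning on the ends \<open>b\<close> and \<open>c\<close> of the
  updated edge.\<close>

lemma (in prob_space) nn_integral_four_indep_unif:
  fixes X :: "'i \<Rightarrow> 'a \<Rightarrow> real"
  assumes indep: "indep_vars (\<lambda>_. borel) X {a, b, c, d}"
    and unif: "\<And>i. i \<in> {a, b, c, d} \<Longrightarrow> distr M borel (X i) = unif"
    and dist: "distinct [a, b, c, d]"
    and [measurable]: "f \<in> borel_measurable (borel \<Otimes>\<^sub>M borel \<Otimes>\<^sub>M borel \<Otimes>\<^sub>M borel)"
  shows "(\<integral>\<^sup>+\<omega>. f (X a \<omega>, X b \<omega>, X c \<omega>, X d \<omega>) \<partial>M) =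
    (\<integral>\<^sup>+x. \<integral>\<^sup>+y. \<integral>\<^sup>+z. \<integral>\<^sup>+w. f (w, x, y, z) \<partial>unif \<partial>unif \<partial>unif \<partial>unif)"
proof -
  let ?I = "{a, b, c, d}"
  have rv [measurable]: "X i \<in> borel_measurable M" if "i \<in> ?I" for i
    using indep that by (auto simp: indep_vars_def)
  have "distr M (Pi\<^sub>M ?I (\<lambda>_. borel)) (\<lambda>\<omega>. \<lambda>i\<in>?I. X i \<omega>) = Pi\<^sub>M ?I (\<lambda>i. distr M borel (X i))"
    using indep rv by (subst (asm) indep_vars_iff_distr_eq_PiM') auto
  also have "\<dots> = Pi\<^sub>M ?I (\<lambda>_. unif)"
    by (rule PiM_cong) (auto simp: unif)
  finally have law: "distr M (Pi\<^sub>M ?I (\<lambda>_. borel)) (\<lambda>\<omega>. \<lambda>i\<in>?I. X i \<omega>) = Pi\<^sub>M ?I (\<lambda>_. unif)" .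
  interpret U: prob_space unif by (rule prob_space_unif)
  interpret P: product_sigma_finite "\<lambda>_. unif" by standard
  have sets_U [measurable_cong]: "sets unif = sets borel" by simp
  have "(\<integral>\<^sup>+\<omega>. f (X a \<omega>, X b \<omega>, X c \<omega>, X d \<omega>) \<partial>M) =
      (\<integral>\<^sup>+p. f (p a, p b, p c, p d) \<partial>distr M (Pi\<^sub>M ?I (\<lambda>_. borel)) (\<lambda>\<omega>. \<lambda>i\<in>?I. X i \<omega>))"
    by (subst nn_integral_distr) auto
  also have "\<dots> = (\<integral>\<^sup>+p. f (p a, p b, p c, p d) \<partial>Pi\<^sub>M ?I (\<lambda>_. unif))"
    by (simp only: law)
  also have "\<dots> = (\<integral>\<^sup>+p. \<integral>\<^sup>+w. f (w, p b, p c, p d) \<partial>unif \<partial>Pi\<^sub>M {b, c, d} (\<lambda>_. unif))"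
    using dist by (subst P.product_nn_integral_insert) auto
  \<comment> \<open>Reordered so that \<open>d\<close> is peeled off before \<open>b\<close> and
    \<open>c\<close>.\<close>
  also have "{b, c, d} = insert d {b, c}" by auto
  also have "(\<integral>\<^sup>+p. \<integral>\<^sup>+w. f (w, p b, p c, p d) \<partial>unif \<partial>Pi\<^sub>M (insert d {b, c}) (\<lambda>_. unif)) =
      (\<integral>\<^sup>+p. \<integral>\<^sup>+z. \<integral>\<^sup>+w. f (w, p b, p c, z) \<partial>unif \<partial>unif \<partial>Pi\<^sub>M {b, c} (\<lambda>_. unif))"
    using dist by (subst P.product_nn_integral_insert) auto
  also have "{b, c} = insert c {b}" by auto
  also have "(\<integral>\<^sup>+p. \<integral>\<^sup>+z. \<integral>\<^sup>+w. f (w, p b, p c, z) \<partial>unif \<partial>unif \<partial>Pi\<^sub>M (insert c {b}) (\<lambda>_. unif)) =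
      (\<integral>\<^sup>+p. \<integral>\<^sup>+y. \<integral>\<^sup>+z. \<integral>\<^sup>+w. f (w, p b, y, z) \<partial>unif \<partial>unif \<partial>unif \<partial>Pi\<^sub>M {b} (\<lambda>_. unif))"
    using dist by (subst P.product_nn_integral_insert) auto
  also have "\<dots> = (\<integral>\<^sup>+x. \<integral>\<^sup>+y. \<integral>\<^sup>+z. \<integral>\<^sup>+w. f (w, x, y, z) \<partial>unif \<partial>unif \<partial>unif \<partial>unif)"
    by (subst P.product_nn_integral_singleton) auto
  finally show ?thesis .
qed

text \<open>For fixed \<open>x\<close> and \<open>y\<close>, each of \<open>z\<close> and
  \<open>w\<close> enters one factor only, so the inner integrals separate, and by invariance they
  depend only on \<open>wrap_pi (y - x)\<close>. That difference is again uniform when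
  \<open>y\<close> is integrated.\<close>

lemma nn_integral_noncross_pair:
  "(\<integral>\<^sup>+x. \<integral>\<^sup>+y. \<integral>\<^sup>+z. \<integral>\<^sup>+w. noncross (wrap_pi (y - x)) (wrap_pi (z - y)) *
      noncross (wrap_pi (y - x)) (wrap_pi (x - w)) \<partial>unif \<partial>unif \<partial>unif \<partial>unif) = ennreal (37 / 48)"
proof -
  interpret U: prob_space unif by (rule prob_space_unif)
  have [measurable]: "noncross x \<in> borel_measurable borel" for x
    unfolding noncross_def[abs_def] by measurable
  define h :: "real \<Rightarrow> ennreal" where "h x = ennreal ((1 - \<bar>x\<bar> / (4 * pi))\<^sup>2)" for x
  have [measurable]: "h \<in> borel_measurable borel"
    unfolding h_def[abs_def] by measurable
  \<comment> \<open>Stated for \<open>u\<close> unrelated to \<open>x\<close> and \<open>y\<close>,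
    and used with \<open>u = wrap_pi (y - x)\<close>. Thus \<open>h u\<close> is the conditional
    probability of no crossing on either side.\<close>
  have "(\<integral>\<^sup>+z. \<integral>\<^sup>+w. noncross u (wrap_pi (z - y)) * noncross u (wrap_pi (x - w)) \<partial>unif \<partial>unif) = h u"
    if u: "u \<in> {-pi..<pi}" for u x y
  proof -
    have "(\<integral>\<^sup>+z. \<integral>\<^sup>+w. noncross u (wrap_pi (z - y)) * noncross u (wrap_pi (x - w)) \<partial>unif \<partial>unif) =
        (\<integral>\<^sup>+z. noncross u (wrap_pi (z - y)) * ennreal (1 - \<bar>u\<bar> / (4 * pi)) \<partial>unif)"
      by (simp add: nn_integral_cmult nn_integral_wrap_pi_diff_left nn_integral_noncross[OF u])
    also have "\<dots> = ennreal (1 - \<bar>u\<bar> / (4 * pi)) * ennreal (1 - \<bar>u\<bar> / (4 * pi))"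
      by (simp add: nn_integral_multc nn_integral_wrap_pi_diff nn_integral_noncross[OF u])
    also have "\<dots> = h u"
      using u by (simp add: h_def power2_eq_square abs_if field_simps flip: ennreal_mult)
    finally show ?thesis .
  qed
  then have "(\<integral>\<^sup>+x. \<integral>\<^sup>+y. \<integral>\<^sup>+z. \<integral>\<^sup>+w. noncross (wrap_pi (y - x)) (wrap_pi (z - y)) *
      noncross (wrap_pi (y - x)) (wrap_pi (x - w)) \<partial>unif \<partial>unif \<partial>unif \<partial>unif) =
      (\<integral>\<^sup>+x. \<integral>\<^sup>+y. h (wrap_pi (y - x)) \<partial>unif \<partial>unif)"
    by (simp add: wrap_pi_in del: atLeastLessThan_iff)
  also have "\<dots> = (\<integral>\<^sup>+x. ennreal (37 / 48) \<partial>unif)"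
    by (simp add: nn_integral_wrap_pi_diff nn_integral_square_unif[folded h_def])
  also have "\<dots> = ennreal (37 / 48)"
    using U.emeasure_space_1 by simp
  finally show ?thesis .
qed

theorem lemma4p5:
  fixes M :: "'a measure" and \<theta>\<^sub>0 :: "nat \<Rightarrow> 'a \<Rightarrow> real" and N k :: nat
  assumes "prob_space M"
    and "N \<ge> 4"
    and "k \<in> {1..N}"
    and "\<And>i \<omega>. i \<in> {1..N} \<Longrightarrow> \<omega> \<in> space M \<Longrightarrow> \<theta>\<^sub>0 i \<omega> \<in> {-pi..<pi}"
    and "prob_space.indep_vars M (\<lambda>_. borel) \<theta>\<^sub>0 {1..N}"
    and "\<And>i. i \<in> {1..N} \<Longrightarrow> distr M borel (\<theta>\<^sub>0 i) = uniform_measure lborel {-pi..<pi}"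
  shows "measure M {\<omega> \<in> space M. branch_crossing N (\<lambda>i. \<theta>\<^sub>0 i \<omega>) k} = 11 / 48"
proof -
  interpret prob_space M by fact
  define a b c d where abcd: "a = ring_index N (k - 1)" "b = ring_index N k"
    "c = ring_index N (k + 1)" "d = ring_index N (k + 2)"
  \<comment> \<open>The extreme indices \<open>k - 1\<close> and \<open>k + 2\<close> are 3 apart,
    hence distinct modulo \<open>N\<close> because \<open>N \<ge> 4\<close>.\<close>
  have dist: "distinct [a, b, c, d]"
    using assms(2,3) ring_index_neq[of "k - 1" k N] ring_index_neq[of "k - 1" "k + 1" N]
      ring_index_neq[of "k - 1" "k + 2" N] ring_index_neq[of k "k + 1" N]
      ring_index_neq[of k "k + 2" N] ring_index_neq[of "k + 1" "k + 2" N]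
    by (simp add: abcd)
  have sub: "{a, b, c, d} \<subseteq> {1..N}"
    using assms(2) ring_index_in[of N] by (simp add: abcd)
  have indep: "indep_vars (\<lambda>_. borel) \<theta>\<^sub>0 {a, b, c, d}"
    using assms(5) sub by (rule indep_vars_subset)
  have rv [measurable]: "\<theta>\<^sub>0 a \<in> borel_measurable M" "\<theta>\<^sub>0 b \<in> borel_measurable M"
      "\<theta>\<^sub>0 c \<in> borel_measurable M" "\<theta>\<^sub>0 d \<in> borel_measurable M"
    using indep by (auto simp: indep_vars_def)
  define f where "f = (\<lambda>(w, x, y, z). noncross (wrap_pi (y - x)) (wrap_pi (z - y)) *
      noncross (wrap_pi (y - x)) (wrap_pi (x - w)))"
  have [measurable]: "f \<in> borel_measurable (borel \<Otimes>\<^sub>M borel \<Otimes>\<^sub>M borel \<Otimes>\<^sub>M borel)"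
    unfolding f_def by measurable
  let ?B = "{\<omega> \<in> space M. branch_crossing N (\<lambda>i. \<theta>\<^sub>0 i \<omega>) k}"
  let ?C = "{\<omega> \<in> space M. \<not> branch_crossing N (\<lambda>i. \<theta>\<^sub>0 i \<omega>) k}"
  \<comment> \<open>Since \<open>k \<ge> 1\<close>, the edge with index \<open>k - 1\<close> does
    end at vertex \<open>k\<close>; for \<open>k = 1\<close> it is the closing edge, starting at
    \<open>N\<close>.\<close>
  have bc: "branch_crossing N (\<lambda>i. \<theta>\<^sub>0 i \<omega>) k \<longleftrightarrow>
      wrap_pi (\<theta>\<^sub>0 d \<omega> - \<theta>\<^sub>0 c \<omega>) + wrap_pi (\<theta>\<^sub>0 c \<omega> - \<theta>\<^sub>0 b \<omega>) / 2 \<notin> {-pi<..<pi} \<or>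
      wrap_pi (\<theta>\<^sub>0 b \<omega> - \<theta>\<^sub>0 a \<omega>) + wrap_pi (\<theta>\<^sub>0 c \<omega> - \<theta>\<^sub>0 b \<omega>) / 2 \<notin> {-pi<..<pi}" for \<omega>
    using assms(3) by (simp add: branch_crossing_def S_plus_def S_minus_def edge_diff_def abcd)
  have meas: "?C \<in> events"
    unfolding bc by measurable
  \<comment> \<open>The complement is computed because it is an intersection of two events, hence
    its indicator is the product \<open>f\<close>.\<close>
  have "emeasure M ?C = (\<integral>\<^sup>+\<omega>. indicator ?C \<omega> \<partial>M)"
    using meas by simp
  also have "\<dots> = (\<integral>\<^sup>+\<omega>. f (\<theta>\<^sub>0 a \<omega>, \<theta>\<^sub>0 b \<omega>, \<theta>\<^sub>0 c \<omega>, \<theta>\<^sub>0 d \<omega>) \<partial>M)"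
    by (intro nn_integral_cong) (auto simp: f_def noncross_def bc indicator_def)
  also have "\<dots> = ennreal (37 / 48)"
    using indep assms(6) sub dist
    by (subst nn_integral_four_indep_unif) (auto simp: f_def nn_integral_noncross_pair)
  finally have "prob ?C = 37 / 48"
    by (simp add: emeasure_eq_measure)
  moreover have "prob ?C = 1 - prob ?B"
  proof -
    have "?C = space M - ?B" "?B = space M - ?C" by auto
    then show ?thesis
      using meas prob_compl[of ?B] by (metis sets.compl_sets)
  qed
  ultimately show ?thesis by simp
qed

end
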